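(* Let $\mathcal{C}$ be a class of groups closed under taking subgroups, quotient groups, and finite direct products. Let $G$ be a subgroup of a direct product $A_1\times\cdots\times A_n$ of groups $A_1,\dots,A_n$. Then $G$ is in the class $\mathcal{C}$ if and only if each $\overline{G}_i$, $1\le i\le n$, is in $\mathcal{C}$.
   Context: For a subgroup $G\le A_1\times\cdots\times A_n$, $\overline{G}_i:=\pi_i(G)\le A_i$, where $\pi_i:A_1\times\cdots\times A_n\to A_i$ is the projection onto the $i$-th factor. As usual, a class of groups is understood to be closed under isomorphism. *)

theory Defs
  imports "HOL-Algebra.Algebra"
begin

text \<open>
  HOL has no quantification over classes of groups living on all types at once. A class of groups
  is therefore represented by an isomorphism-closed set \<open>C\<close> of groups over one arbitrary
  type \<open>'u\<close>, and a group over any type \<open>'a\<close> belongs to the class if it is isomorphic to a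
  member of \<open>C\<close> (\<open>in_class\<close> below).

  Nothing is lost: given a class of groups and some groups, take for \<open>'u\<close> an infinite
  type at least as large as all of them, and for \<open>C\<close> the groups of the class that live on \<open>'u\<close>.
  Subgroups, quotients and finite direct products of groups of cardinality at most that of
  \<open>'u\<close> again have cardinality at most that of \<open>'u\<close>, so the closure properties are inherited.
\<close>

definition group_class :: "'u monoid set \<Rightarrow> bool" where
  "group_class C \<longleftrightarrow>
     (\<forall>K\<in>C. group K) \<and> (\<forall>K\<in>C. \<forall>L. group L \<and> K \<cong> L \<longrightarrow> L \<in> C)"

definition in_class :: "'a monoid \<Rightarrow> 'u monoid set \<Rightarrow> bool" where
  "in_class G C \<longleftrightarrow> group G \<and> (\<exists>K\<in>C. K \<cong> G)"

lemma in_class_iff_mem: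
  fixes K :: "'u monoid" and C :: "'u monoid set"
  assumes "group_class C"
  shows "in_class K C \<longleftrightarrow> K \<in> C"
  using assms iso_refl unfolding group_class_def in_class_def by blast

definition subgroup_closed :: "'u monoid set \<Rightarrow> bool" where
  "subgroup_closed C \<longleftrightarrow> (\<forall>K\<in>C. \<forall>H. subgroup H K \<longrightarrow> K\<lparr>carrier := H\<rparr> \<in> C)"

definition quotient_closed :: "'u monoid set \<Rightarrow> bool" where
  "quotient_closed C \<longleftrightarrow> (\<forall>K\<in>C. \<forall>N. N \<lhd> K \<longrightarrow> in_class (K Mod N) C)"

text \<open>
  Only products with at least one factor are required, so that the empty class is not excluded.
\<close>

definition finite_product_closed :: "'u monoid set \<Rightarrow> bool" where
  "finite_product_closed C \<longleftrightarrow>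
     (\<forall>(n::nat) K. 1 \<le> n \<longrightarrow> (\<forall>i\<in>{1..n}. K i \<in> C) \<longrightarrow> in_class (product_group {1..n} K) C)"

definition proj_group :: "('i \<Rightarrow> 'a monoid) \<Rightarrow> ('i \<Rightarrow> 'a) set \<Rightarrow> 'i \<Rightarrow> 'a monoid" where
  "proj_group A G i = (A i)\<lparr>carrier := (\<lambda>x. x i) ` G\<rparr>"

end

theory Submission
  imports Defs
begin

text \<open>Each coordinate map is a homomorphism taking \<open>G\<close> onto its image in
  \<open>A i\<close>, so by the first isomorphism theorem that image is a quotient of
  \<open>G\<close> up to isomorphism. Conversely, the coordinates of any element of \<open>G\<close>
  lie in these images, so \<open>G\<close> is a subgroup of their finite direct product. The closure
  hypotheses concern groups on the type \<open>'u\<close> only. \<open>in_class_subgroup\<close>,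
  \<open>in_class_epi\<close> and \<open>in_class_product_group\<close> carry them over to groups on
  other types, by passing to isomorphic members of \<open>C\<close>.\<close>

lemma in_class_iso:
  assumes "in_class G C" "group H" "G \<cong> H"
  shows "in_class H C"
  using assms unfolding in_class_def by (meson iso_trans)

text \<open>An isomorphism from \<open>G\<close> to a member \<open>K\<close> of \<open>C\<close>
  restricts to one from \<open>H\<close> to its image, and closure applies to that image inside
  \<open>K\<close>.\<close>

lemma in_class_subgroup:
  fixes C :: "'u monoid set" and G :: "'a monoid"
  assumes "group_class C" "subgroup_closed C" "in_class G C" "subgroup H G"
  shows "in_class (G\<lparr>carrier := H\<rparr>) C"
proof -
  obtain K where K: "K \<in> C" "K \<cong> G" and G: "group G"
    using assms(3) unfolding in_class_def by blast
  have K_group: "group K"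
    using assms(1) K(1) unfolding group_class_def by blast
  obtain f where f: "f \<in> iso G K"
    using group.iso_sym[OF K_group K(2)] unfolding is_iso_def by blast
  interpret group_hom G K f
    using f G K_group by (simp add: group_hom_def group_hom_axioms_def iso_def)
  have "K\<lparr>carrier := f ` H\<rparr> \<in> C"
    using assms(2) K(1) subgroup_img_is_subgroup[OF assms(4)] unfolding subgroup_closed_def by blast
  moreover have "G\<lparr>carrier := H\<rparr> \<cong> K\<lparr>carrier := f ` H\<rparr>"
    using iso_restrict[OF f G K_group assms(4)] unfolding is_iso_def by blast
  moreover have "group (G\<lparr>carrier := H\<rparr>)"
    using G.subgroup_imp_group[OF assms(4)] .
  ultimately show ?thesis
    unfolding in_class_def using group.iso_sym by blast
qed

text \<open>Closure under quotients in the form of closure under homomorphic images, by the first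
  isomorphism theorem.\<close>

lemma in_class_epi:
  fixes C :: "'u monoid set" and G :: "'a monoid" and H :: "'b monoid"
  assumes "group_class C" "quotient_closed C" "in_class G C" "group H" "f \<in> epi G H"
  shows "in_class H C"
proof -
  obtain K k where K: "K \<in> C" "k \<in> iso K G"
    using assms(3) unfolding in_class_def is_iso_def by blast
  have K_group: "group K"
    using assms(1) K(1) unfolding group_class_def by blast
  \<comment> \<open>Precomposing with \<open>k\<close> presents \<open>H\<close> as an image of a
    member of \<open>C\<close>, so that the quotient to be formed is one of \<open>K\<close>, where
    \<open>quotient_closed\<close> applies.\<close>
  have fk: "f \<circ> k \<in> epi K H"
    using K(2) assms(5) by (auto simp: iso_iff_mon_epi intro: epi_compose)
  interpret group_hom K H "f \<circ> k"
    using fk assms(4) K_group by (simp add: group_hom_def group_hom_axioms_def epi_def)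
  have "in_class (K Mod kernel K H (f \<circ> k)) C"
    using assms(2) K(1) normal_kernel unfolding quotient_closed_def by blast
  moreover have "K Mod kernel K H (f \<circ> k) \<cong> H"
    using FactGroup_iso_set fk unfolding is_iso_def epi_def by blast
  ultimately show ?thesis
    using in_class_iso assms(4) by blast
qed

text \<open>Replace each factor by an isomorphic member of \<open>C\<close>; isomorphisms of the
  factors combine to one of the products.\<close>

lemma in_class_product_group:
  fixes C :: "'u monoid set" and B :: "nat \<Rightarrow> 'a monoid"
  assumes "group_class C" "finite_product_closed C" "1 \<le> n"
    and "\<And>i. i \<in> {1..n} \<Longrightarrow> in_class (B i) C"
  shows "in_class (product_group {1..n} B) C"
proof -
  obtain K where K: "\<And>i. i \<in> {1..n} \<Longrightarrow> K i \<in> C" "\<And>i. i \<in> {1..n} \<Longrightarrow> K i \<cong> B i"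
    using assms(4) unfolding in_class_def by metis
  have groups: "group (K i)" "group (B i)" if "i \<in> {1..n}" for i
    using assms(1,4) K(1) that unfolding group_class_def in_class_def by blast+
  have "in_class (product_group {1..n} K) C"
    using assms(2,3) K(1) unfolding finite_product_closed_def by blast
  moreover have "product_group {1..n} K \<cong> product_group {1..n} B"
    using K(2) groups by (intro iso_product_groupI)
  ultimately show ?thesis
    using in_class_iso product_group groups(2) by blast
qed

lemma hom_component:
  assumes "i \<in> I"
  shows "(\<lambda>x. x i) \<in> hom (product_group I A) (A i)"
  using assms by (auto simp: hom_def)

lemma subgroup_component_image:
  assumes "\<And>i. i \<in> I \<Longrightarrow> group (A i)" "subgroup G (product_group I A)" "i \<in> I"
  shows "subgroup ((\<lambda>x. x i) ` G) (A i)"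
proof -
  interpret group_hom "product_group I A" "A i" "\<lambda>x. x i"
    using assms hom_component by (simp add: group_hom_def group_hom_axioms_def)
  show ?thesis
    using subgroup_img_is_subgroup[OF assms(2)] .
qed

lemma group_proj_group:
  assumes "\<And>i. i \<in> I \<Longrightarrow> group (A i)" "subgroup G (product_group I A)" "i \<in> I"
  shows "group (proj_group A G i)"
  unfolding proj_group_def
  using assms subgroup_component_image group.subgroup_imp_group by metis

lemma component_epi_proj_group:
  assumes "i \<in> I"
  shows "(\<lambda>x. x i) \<in> epi ((product_group I A)\<lparr>carrier := G\<rparr>) (proj_group A G i)"
  using assms by (auto simp: epi_def hom_def proj_group_def)

text \<open>An equality, not just an isomorphism: \<open>proj_group\<close> changes only the carrier
  of \<open>A i\<close>, so the product keeps its multiplication and unit.\<close>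

lemma product_group_proj_group:
  "product_group I (proj_group A G) =
    (product_group I A)\<lparr>carrier := (\<Pi>\<^sub>E i\<in>I. (\<lambda>x. x i) ` G)\<rparr>"
  by (simp add: product_group_def proj_group_def)

lemma subgroup_product_group_proj_group:
  assumes "\<And>i. i \<in> I \<Longrightarrow> group (A i)" "subgroup G (product_group I A)"
  shows "subgroup G (product_group I (proj_group A G))"
  unfolding product_group_proj_group
proof (rule group.subgroup_incl)
  show "group (product_group I A)"
    using assms(1) by simp
  show "subgroup (\<Pi>\<^sub>E i\<in>I. (\<lambda>x. x i) ` G) (product_group I A)"
    using subgroup_component_image[OF assms] PiE_subgroup_product_group[of I A, OF assms(1)]
    by blast
  \<comment> \<open>The coordinates lie in the images trivially; that elements of \<open>G\<close>
    are \<open>undefined\<close> outside \<open>I\<close> comes from the carrier of the full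
    product.\<close>
  show "G \<subseteq> (\<Pi>\<^sub>E i\<in>I. (\<lambda>x. x i) ` G)"
    using subgroup.subset[OF assms(2)] by (auto simp: PiE_iff)
qed (fact assms(2))

theorem proposition4p1:
  fixes C :: "'u monoid set"
    and n :: nat
    and A :: "nat \<Rightarrow> 'a monoid"
    and G :: "(nat \<Rightarrow> 'a) set"
  assumes "group_class C"
    and "subgroup_closed C"
    and "quotient_closed C"
    and "finite_product_closed C"
    and "1 \<le> n"
    and "\<And>i. i \<in> {1..n} \<Longrightarrow> group (A i)"
    and "subgroup G (product_group {1..n} A)"
  shows "in_class ((product_group {1..n} A)\<lparr>carrier := G\<rparr>) C \<longleftrightarrow>
         (\<forall>i\<in>{1..n}. in_class (proj_group A G i) C)"
proof
  assume "in_class ((product_group {1..n} A)\<lparr>carrier := G\<rparr>) C"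
  then show "\<forall>i\<in>{1..n}. in_class (proj_group A G i) C"
    using in_class_epi[OF assms(1,3) _ group_proj_group[OF assms(6,7)] component_epi_proj_group]
    by blast
next
  assume "\<forall>i\<in>{1..n}. in_class (proj_group A G i) C"
  then have "in_class (product_group {1..n} (proj_group A G)) C"
    using in_class_product_group[OF assms(1,4,5)] by blast
  then have "in_class ((product_group {1..n} (proj_group A G))\<lparr>carrier := G\<rparr>) C"
    using in_class_subgroup[OF assms(1,2)] subgroup_product_group_proj_group[OF assms(6,7)] by blast
  \<comment> \<open>The two products differ only in their carriers, and \<open>G\<close> overwrites
    both.\<close>
  then show "in_class ((product_group {1..n} A)\<lparr>carrier := G\<rparr>) C"
    by (simp add: product_group_proj_group)
qed

end
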